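(* Consider the robust access allocation problem (R) defined in the context, with the LinDistFlow matrix $\mathbf A$ of a radial network on buses $1,\dots,N$, and a primal-dual optimal solution (denoted by $\star$) with access prices $\overline{\boldsymbol\lambda}^\star,\underline{\boldsymbol\lambda}^\star\in\mathbb{R}^N$. Suppose that $J$ is linear and homogeneous across buses, i.e., $J(\overline{\mathbf P},\underline{\mathbf P})=\sum_{i=1}^N\overline J\,\overline P^{(i)}+\sum_{i=1}^N\underline J\,\underline P^{(i)}$ for scalars $\overline J,\underline J$, and that the constraints $\overline{\mathbf P}\le\overline{\mathbf P}^{\max}$, $\underline{\mathbf P}\le\underline{\mathbf P}^{\max}$ are non-binding at optimality at all buses (i.e., $\overline P^{(i)\star}<\overline P^{\max(i)}$ and $\underline P^{(i)\star}<\underline P^{\max(i)}$ for all $i$). Then, whenever bus $m$ is an ancestor of bus $n$, $$\overline\lambda^{(n)\star}\ge\overline\lambda^{(m)\star}\quad\text{and}\quad\underline\lambda^{(n)\star}\ge\underline\lambda^{(m)\star}.$$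
   Context: All vector inequalities are element-wise; superscript $(i)$ denotes the $i$-th (bus $i$) component. For a scalar $z$, $z_+:=\max\{z,0\}$, $z_-:=z_+-z$, applied element-wise to matrices, so $\mathbf A=\mathbf A_+-\mathbf A_-$. Network. The distribution network is a tree on buses $\{1,\dots,N\}$ with $N-1$ edges (lines); bus $1$ is the reference bus. Bus $m$ is an ancestor of bus $n$ if $m$ lies on the unique undirected path from bus $1$ to bus $n$. Let $\tilde{\mathbf S}\in\{0,1\}^{(N-1)\times(N-1)}$ be the reduced path matrix, rows indexed by edges $e$ and columns by buses $j=2,\dots,N$, with $\tilde S^{(e,j)}=1$ if edge $e$ lies on the path between bus $1$ and bus $j$, and $0$ otherwise. Let $\mathbf D=\mathrm{diag}(\mathbf r+\alpha\mathbf x)$, where $\mathbf r,\mathbf x\in\mathbb{R}^{N-1}$ collect line resistances and reactances and $\alpha$ is the fixed ratio of reactive to real power injection; $\mathbf D$ is element-wise nonnegative. The LinDistFlow matrix is $$\mathbf A=\begin{pmatrix}\mathbf 0&\tilde{\mathbf S}\\ \mathbf 0&2\tilde{\mathbf S}^\top\mathbf D\tilde{\mathbf S}\end{pmatrix}\in\mathbb{R}^{2(N-1)\times N},$$ where the first (zero) column corresponds to bus $1$. The vectors $\underline{\mathbf b},\overline{\mathbf b}\in\mathbb{R}^{2(N-1)}$ collect the lower and upper limits on line flows and on squared voltage magnitudes (the latter offset by the contribution of the reference bus voltage). Problem (R). Further data: positive integer $K$; element-wise nonnegative $\overline{\mathbf C}_k^{\min},\underline{\mathbf C}_k^{\min},\overline{\mathbf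 P}^{\max},\underline{\mathbf P}^{\max}\in\mathbb{R}^N$; $\overline{\mathbf p}_0,\underline{\mathbf p}_0\in\mathbb{R}^N$ with $-\underline{\mathbf p}_0\le\overline{\mathbf p}_0$; concave non-decreasing $\varphi_k:\mathbb{R}^{2N}\to\mathbb{R}$, $k=1,\dots,K$; convex non-decreasing $J:\mathbb{R}^{2N}\to\mathbb{R}$. Over $\overline{\mathbf C}_k,\underline{\mathbf C}_k,\overline{\mathbf P},\underline{\mathbf P}\in\mathbb{R}^N$, maximize $\sum_{k=1}^K\varphi_k(\underline{\mathbf C}_k,\overline{\mathbf C}_k)-J(\overline{\mathbf P},\underline{\mathbf P})$ subject to (multipliers in brackets) - $[\overline{\boldsymbol\eta}_k,\underline{\boldsymbol\eta}_k\ge0]$: $\overline{\mathbf C}_k^{\min}\le\overline{\mathbf C}_k$, $\underline{\mathbf C}_k^{\min}\le\underline{\mathbf C}_k$ for each $k$; - $[\overline{\boldsymbol\omega},\underline{\boldsymbol\omega}\ge0]$: $\overline{\mathbf P}\le\overline{\mathbf P}^{\max}$, $\underline{\mathbf P}\le\underline{\mathbf P}^{\max}$; - $[\overline{\boldsymbol\lambda},\underline{\boldsymbol\lambda}\text{ free}]$: $\overline{\mathbf P}=\sum_k\overline{\mathbf C}_k+\overline{\mathbf p}_0$, $\underline{\mathbf P}=\sum_k\underline{\mathbf C}_k+\underline{\mathbf p}_0$; - $[\overline{\boldsymbol\mu}\ge0]$: $\mathbf A_+\overline{\mathbf P}+\mathbf A_-\underline{\mathbf P}\le\overline{\mathbf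 b}$; - $[\underline{\boldsymbol\mu}\ge0]$: $\underline{\mathbf b}\le-\mathbf A_+\underline{\mathbf P}-\mathbf A_-\overline{\mathbf P}$. The Lagrangian (sign convention) is $$\mathcal L=J(\overline{\mathbf P},\underline{\mathbf P})-\sum_k\varphi_k(\underline{\mathbf C}_k,\overline{\mathbf C}_k)+\overline{\boldsymbol\lambda}^\top\Big(\sum_k\overline{\mathbf C}_k+\overline{\mathbf p}_0-\overline{\mathbf P}\Big)+\underline{\boldsymbol\lambda}^\top\Big(\sum_k\underline{\mathbf C}_k+\underline{\mathbf p}_0-\underline{\mathbf P}\Big)+\sum_k\overline{\boldsymbol\eta}_k^\top(\overline{\mathbf C}_k^{\min}-\overline{\mathbf C}_k)+\sum_k\underline{\boldsymbol\eta}_k^\top(\underline{\mathbf C}_k^{\min}-\underline{\mathbf C}_k)$$ $$+\overline{\boldsymbol\mu}^\top(\mathbf A_+\overline{\mathbf P}+\mathbf A_-\underline{\mathbf P}-\overline{\mathbf b})+\underline{\boldsymbol\mu}^\top(\mathbf A_+\underline{\mathbf P}+\mathbf A_-\overline{\mathbf P}+\underline{\mathbf b})+\overline{\boldsymbol\omega}^\top(\overline{\mathbf P}-\overline{\mathbf P}^{\max})+\underline{\boldsymbol\omega}^\top(\underline{\mathbf P}-\underline{\mathbf P}^{\max}).$$ A primal-dual optimal solution means: the primal point is feasible, the inequality multipliers are nonnegative, complementary slackness holds for every inequality constraint, and the primal point minimizes $\mathcal L$ (at the given multipliers) over all $\overline{\mathbf C}_k,\underline{\mathbf C}_k,\overline{\mathbf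 P},\underline{\mathbf P}\in\mathbb{R}^N$. The access prices (LMAP-R) are the components $\overline{\boldsymbol\lambda}^\star,\underline{\boldsymbol\lambda}^\star$. *)

theory Defs
  imports "HOL-Analysis.Analysis"
begin

text \<open>Simple undirected graphs whose vertex set is the whole type; an edge is the set of its
  two endpoints.\<close>

definition upath :: "'v set set \<Rightarrow> 'v \<Rightarrow> 'v list \<Rightarrow> 'v \<Rightarrow> bool" where
  "upath E u p v \<longleftrightarrow> p \<noteq> [] \<and> hd p = u \<and> last p = v \<and> distinct p \<and>
     successively (\<lambda>a b. {a, b} \<in> E) p"

definition ucycle :: "'v set set \<Rightarrow> 'v list \<Rightarrow> bool" where
  "ucycle E c \<longleftrightarrow> 3 \<le> length c \<and> distinct c \<and>
     successively (\<lambda>a b. {a, b} \<in> E) c \<and> {last c, hd c} \<in> E"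

definition tree :: "'v set set \<Rightarrow> bool" where
  "tree E \<longleftrightarrow> (\<forall>e\<in>E. card e = 2) \<and> (\<forall>u v. \<exists>p. upath E u p v) \<and> (\<nexists>c. ucycle E c)"

lemma acyclic_upath_unique:
  assumes ac: "\<nexists>c. ucycle E c" and "upath E u p v" "upath E u q v"
  shows "p = q"
  using assms(2,3)
proof (induction p arbitrary: u q)
  case Nil
  then show ?case by (simp add: upath_def)
next
  case (Cons u' p')
  then have [simp]: "u' = u" by (simp add: upath_def)
  from Cons.prems(2) obtain q' where q: "q = u # q'"
    by (cases q) (auto simp: upath_def)
  show ?case
  proof (cases "p' = [] \<or> q' = []")
    case True
    then show ?thesis using Cons.prems q
      by (auto simp: upath_def split: if_splits)
  next
    case False
    then obtain a p2 b q2 where p': "p' = a # p2" and q': "q' = b # q2"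
      by (metis list.exhaust)
    show ?thesis
    proof (cases "a = b")
      case True
      then have "upath E a p' v" "upath E a q' v"
        using Cons.prems by (auto simp: upath_def p' q' q)
      from Cons.IH[OF this] show ?thesis by (simp add: q)
    next
      case ab: False
      have "last p' = v" "last q' = v" using Cons.prems
        by (simp_all add: upath_def p' q' q)
      then have "v \<in> set p'" "v \<in> set q'"
        using last_in_set[of p'] last_in_set[of q'] p' q' by auto
      then have "\<exists>x\<in>set p'. x \<in> set q'" by blast
      then obtain ys w zs where ys: "p' = ys @ w # zs" "w \<in> set q'" "\<forall>y\<in>set ys. y \<notin> set q'"
        by (rule split_list_first_propE)
      from \<open>w \<in> set q'\<close> obtain ys2 zs2 where ys2: "q' = ys2 @ w # zs2"
        by (meson split_list)
      let ?R = "\<lambda>a b. {a, b} \<in> E"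
      have sym: "?R y x = ?R x y" for x y by (simp add: insert_commute)
      have 1: "successively ?R (u # ys @ [w])" "distinct (u # ys @ [w])"
        using Cons.prems(1) unfolding upath_def ys(1)
        by (auto simp: successively_append_iff successively_Cons hd_append split: if_splits)
      have 2: "successively ?R (u # ys2 @ [w])" "distinct (u # ys2 @ [w])"
        using Cons.prems(2) unfolding upath_def q ys2
        by (auto simp: successively_append_iff successively_Cons hd_append split: if_splits)
      have 3: "successively ?R (rev (u # ys2 @ [w]))"
        using 2(1) by (simp only: successively_rev sym)
      let ?c = "(u # ys @ [w]) @ rev ys2"
      have "ys \<noteq> [] \<or> ys2 \<noteq> []" using ab p' q' ys ys2 by auto
      then have "3 \<le> length ?c" by (cases ys; cases ys2) auto
      moreover have "distinct ?c" using 1(2) 2(2) ys(3) ys2 by auto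
      moreover have "successively ?R ?c"
      proof -
        have "successively ?R (w # rev ys2)"
          using 3 successively_append_iff[of ?R "w # rev ys2" "[u]"] by simp
        then show ?thesis
          using 1(1) successively_append_iff[of ?R "u # ys @ [w]" "rev ys2"]
          by (auto simp: successively_Cons)
      qed
      moreover have "{last ?c, hd ?c} \<in> E"
        using 2(1) by (cases ys2) (auto simp: insert_commute last_rev)
      ultimately have "ucycle E ?c" unfolding ucycle_def by blast
      with ac show ?thesis by blast
    qed
  qed
qed

lemma tree_ex1_upath: "tree E \<Longrightarrow> \<exists>!p. upath E u p v"
  unfolding tree_def using acyclic_upath_unique[of E] by blast

definition tree_path :: "'v set set \<Rightarrow> 'v \<Rightarrow> 'v \<Rightarrow> 'v list" where
  "tree_path E u v = (THE p. upath E u p v)"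

definition path_edges :: "'v list \<Rightarrow> 'v set set" where
  "path_edges p = {{p ! i, p ! Suc i} |i. Suc i < length p}"


text \<open>The buses are the elements of the finite type \<open>'n\<close>, so that \<open>N = CARD('n)\<close>. The resistance
  and reactance of a line, and more generally every quantity indexed by lines, is only meaningful
  on the set of lines.\<close>

record 'n network =
  ref_bus :: 'n
  lines :: "'n set set"
  resistance :: "'n set \<Rightarrow> real"
  reactance :: "'n set \<Rightarrow> real"
  reactive_ratio :: real

definition ancestor :: "'n network \<Rightarrow> 'n \<Rightarrow> 'n \<Rightarrow> bool" where
  "ancestor G m n \<longleftrightarrow> m \<in> set (tree_path (lines G) (ref_bus G) n)"

text \<open>The reduced path matrix, padded with zero rows (sets that are not lines) and a zero column
  (the reference bus); the padding does not affect the products in \<open>lindistflow\<close> below.\<close>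

definition path_matrix :: "('n::finite) network \<Rightarrow> real ^ 'n ^ ('n set)" where
  "path_matrix G = (\<chi> e j. if e \<in> lines G \<and> j \<noteq> ref_bus G \<and>
      e \<in> path_edges (tree_path (lines G) (ref_bus G) j) then 1 else 0)"

definition impedance_matrix :: "('n::finite) network \<Rightarrow> real ^ ('n set) ^ ('n set)" where
  "impedance_matrix G =
     (\<chi> e f. if e = f then resistance G e + reactive_ratio G * reactance G e else 0)"

text \<open>Rows \<open>Inl e\<close> are the line flow limits, rows \<open>Inr i\<close> the voltage limits. Only the
  \<open>2 * (N - 1)\<close> rows in \<open>limit_rows\<close> belong to the LinDistFlow matrix.\<close>

definition limit_rows :: "'n network \<Rightarrow> ('n set + 'n) set" where
  "limit_rows G = lines G <+> (UNIV - {ref_bus G})"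

definition lindistflow :: "('n::finite) network \<Rightarrow> real ^ 'n ^ ('n set + 'n)" where
  "lindistflow G = (\<chi> l j. if j = ref_bus G then 0 else
     (case l of
        Inl e \<Rightarrow> path_matrix G $ e $ j
      | Inr i \<Rightarrow>
          (2 *\<^sub>R (transpose (path_matrix G) ** impedance_matrix G ** path_matrix G)) $ i $ j))"

definition mat_pos :: "real ^ 'n ^ 'm \<Rightarrow> real ^ 'n ^ 'm" where
  "mat_pos M = (\<chi> i j. max (M $ i $ j) 0)"

definition mat_neg :: "real ^ 'n ^ 'm \<Rightarrow> real ^ 'n ^ 'm" where
  "mat_neg M = mat_pos M - M"


text \<open>Suffixes \<open>_up\<close> and \<open>_dn\<close> stand for overlined and underlined symbols. The classes are
  \<open>1, \<dots>, num_classes\<close>. The argument order is that of the source: \<open>utility k (C_dn, C_up)\<close> but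
  \<open>cost (P_up, P_dn)\<close>.\<close>

record 'n access_problem =
  network :: "'n network"
  num_classes :: nat
  utility :: "nat \<Rightarrow> (real ^ 'n) \<times> (real ^ 'n) \<Rightarrow> real"
  cost :: "(real ^ 'n) \<times> (real ^ 'n) \<Rightarrow> real"
  Cmin_up :: "nat \<Rightarrow> real ^ 'n"
  Cmin_dn :: "nat \<Rightarrow> real ^ 'n"
  Pmax_up :: "real ^ 'n"
  Pmax_dn :: "real ^ 'n"
  p0_up :: "real ^ 'n"
  p0_dn :: "real ^ 'n"
  b_up :: "real ^ ('n set + 'n)"
  b_dn :: "real ^ ('n set + 'n)"

record 'n primal_point =
  C_up :: "nat \<Rightarrow> real ^ 'n"
  C_dn :: "nat \<Rightarrow> real ^ 'n"
  P_up :: "real ^ 'n"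
  P_dn :: "real ^ 'n"

record 'n dual_point =
  eta_up :: "nat \<Rightarrow> real ^ 'n"
  eta_dn :: "nat \<Rightarrow> real ^ 'n"
  omega_up :: "real ^ 'n"
  omega_dn :: "real ^ 'n"
  lambda_up :: "real ^ 'n"
  lambda_dn :: "real ^ 'n"
  mu_up :: "real ^ ('n set + 'n)"
  mu_dn :: "real ^ ('n set + 'n)"

definition radial_network :: "('n::finite) network \<Rightarrow> bool" where
  "radial_network G \<longleftrightarrow> tree (lines G) \<and>
     (\<forall>e\<in>lines G. 0 \<le> resistance G e + reactive_ratio G * reactance G e)"

text \<open>The order on \<open>real ^ 'n\<close> and on pairs of such vectors is the component-wise one.\<close>

definition robust_access_problem :: "('n::finite) access_problem \<Rightarrow> bool" where
  "robust_access_problem R \<longleftrightarrow>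
     radial_network (network R) \<and>
     1 \<le> num_classes R \<and>
     (\<forall>k\<in>{1..num_classes R}. 0 \<le> Cmin_up R k \<and> 0 \<le> Cmin_dn R k) \<and>
     0 \<le> Pmax_up R \<and> 0 \<le> Pmax_dn R \<and>
     - p0_dn R \<le> p0_up R \<and>
     (\<forall>k\<in>{1..num_classes R}. concave_on UNIV (utility R k) \<and> mono (utility R k)) \<and>
     convex_on UNIV (cost R) \<and> mono (cost R)"

definition A_pos :: "('n::finite) access_problem \<Rightarrow> real ^ 'n ^ ('n set + 'n)" where
  "A_pos R = mat_pos (lindistflow (network R))"

definition A_neg :: "('n::finite) access_problem \<Rightarrow> real ^ 'n ^ ('n set + 'n)" where
  "A_neg R = mat_neg (lindistflow (network R))"

definition feasible :: "('n::finite) access_problem \<Rightarrow> 'n primal_point \<Rightarrow> bool" where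
  "feasible R X \<longleftrightarrow>
     (\<forall>k\<in>{1..num_classes R}. Cmin_up R k \<le> C_up X k \<and> Cmin_dn R k \<le> C_dn X k) \<and>
     P_up X \<le> Pmax_up R \<and> P_dn X \<le> Pmax_dn R \<and>
     P_up X = (\<Sum>k=1..num_classes R. C_up X k) + p0_up R \<and>
     P_dn X = (\<Sum>k=1..num_classes R. C_dn X k) + p0_dn R \<and>
     (\<forall>l\<in>limit_rows (network R).
        (A_pos R *v P_up X + A_neg R *v P_dn X) $ l \<le> b_up R $ l \<and>
        b_dn R $ l \<le> (- (A_pos R *v P_dn X) - A_neg R *v P_up X) $ l)"

definition lagrangian ::
    "('n::finite) access_problem \<Rightarrow> 'n dual_point \<Rightarrow> 'n primal_point \<Rightarrow> real" where
  "lagrangian R Y X =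
     cost R (P_up X, P_dn X) - (\<Sum>k=1..num_classes R. utility R k (C_dn X k, C_up X k))
     + lambda_up Y \<bullet> ((\<Sum>k=1..num_classes R. C_up X k) + p0_up R - P_up X)
     + lambda_dn Y \<bullet> ((\<Sum>k=1..num_classes R. C_dn X k) + p0_dn R - P_dn X)
     + (\<Sum>k=1..num_classes R. eta_up Y k \<bullet> (Cmin_up R k - C_up X k))
     + (\<Sum>k=1..num_classes R. eta_dn Y k \<bullet> (Cmin_dn R k - C_dn X k))
     + (\<Sum>l\<in>limit_rows (network R).
          mu_up Y $ l * (A_pos R *v P_up X + A_neg R *v P_dn X - b_up R) $ l)
     + (\<Sum>l\<in>limit_rows (network R).
          mu_dn Y $ l * (A_pos R *v P_dn X + A_neg R *v P_up X + b_dn R) $ l)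
     + omega_up Y \<bullet> (P_up X - Pmax_up R)
     + omega_dn Y \<bullet> (P_dn X - Pmax_dn R)"

definition dual_nonneg :: "('n::finite) access_problem \<Rightarrow> 'n dual_point \<Rightarrow> bool" where
  "dual_nonneg R Y \<longleftrightarrow>
     (\<forall>k\<in>{1..num_classes R}. 0 \<le> eta_up Y k \<and> 0 \<le> eta_dn Y k) \<and>
     0 \<le> omega_up Y \<and> 0 \<le> omega_dn Y \<and>
     (\<forall>l\<in>limit_rows (network R). 0 \<le> mu_up Y $ l \<and> 0 \<le> mu_dn Y $ l)"

definition compl_slack ::
    "('n::finite) access_problem \<Rightarrow> 'n primal_point \<Rightarrow> 'n dual_point \<Rightarrow> bool" where
  "compl_slack R X Y \<longleftrightarrow>
     (\<forall>k\<in>{1..num_classes R}. \<forall>i.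
        eta_up Y k $ i * (Cmin_up R k - C_up X k) $ i = 0 \<and>
        eta_dn Y k $ i * (Cmin_dn R k - C_dn X k) $ i = 0) \<and>
     (\<forall>i. omega_up Y $ i * (P_up X - Pmax_up R) $ i = 0 \<and>
          omega_dn Y $ i * (P_dn X - Pmax_dn R) $ i = 0) \<and>
     (\<forall>l\<in>limit_rows (network R).
        mu_up Y $ l * (A_pos R *v P_up X + A_neg R *v P_dn X - b_up R) $ l = 0 \<and>
        mu_dn Y $ l * (A_pos R *v P_dn X + A_neg R *v P_up X + b_dn R) $ l = 0)"

definition primal_dual_optimal ::
    "('n::finite) access_problem \<Rightarrow> 'n primal_point \<Rightarrow> 'n dual_point \<Rightarrow> bool" where
  "primal_dual_optimal R X Y \<longleftrightarrow>
     feasible R X \<and> dual_nonneg R Y \<and> compl_slack R X Y \<and>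
     (\<forall>X'. lagrangian R Y X \<le> lagrangian R Y X')"

end

theory Submission
  imports Defs
begin

text \<open>The Lagrangian is affine in the access limits \<open>P\<close>, so its minimality at the optimum
  along the direction \<open>d = e\<^sub>m - e\<^sub>n\<close> bounds \<open>\<lambda>\<^sub>m - \<lambda>\<^sub>n\<close> by the \<open>\<mu>\<close>-weighted sum of the column
  differences \<open>A\<^sub>m - A\<^sub>n\<close>: the homogeneous linear cost is constant along \<open>d\<close>, the multipliers
  \<open>\<omega>\<close> vanish by complementary slackness, and \<open>A\<close> is nonnegative, so that \<open>A\<^sub>- = 0\<close>.
  Since the path to an ancestor \<open>m\<close> of \<open>n\<close> is an initial segment of the path to \<open>n\<close>, column
  \<open>m\<close> is dominated by column \<open>n\<close>, and the bound is nonpositive.\<close>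

lemma tree_path_eqI: "tree E \<Longrightarrow> upath E u p v \<Longrightarrow> tree_path E u v = p"
  unfolding tree_path_def using tree_ex1_upath by (metis the_equality)

lemma upath_tree_path: "tree E \<Longrightarrow> upath E u (tree_path E u v) v"
  unfolding tree_path_def by (rule theI') (rule tree_ex1_upath)

lemma upath_prefix:
  assumes "upath E u (xs @ v # ys) w"
  shows "upath E u (xs @ [v]) v"
  using assms by (auto simp: upath_def successively_append_iff hd_append)

lemma path_edges_prefix_subset: "path_edges xs \<subseteq> path_edges (xs @ ys)"
proof
  fix e assume "e \<in> path_edges xs"
  then obtain i where "Suc i < length xs" "e = {xs ! i, xs ! Suc i}"
    by (auto simp: path_edges_def)
  then show "e \<in> path_edges (xs @ ys)"
    unfolding path_edges_def by (intro CollectI exI[of _ i]) (auto simp: nth_append)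
qed

text \<open>Cutting the path to \<open>w\<close> at \<open>v\<close> leaves a path to
  \<open>v\<close>, which is \<open>tree_path E u v\<close> because paths in a tree are
  unique.\<close>

lemma path_edges_tree_path_subset:
  assumes "tree E" "v \<in> set (tree_path E u w)"
  shows "path_edges (tree_path E u v) \<subseteq> path_edges (tree_path E u w)"
proof -
  obtain xs ys where eq: "tree_path E u w = xs @ v # ys"
    using assms(2) by (meson split_list)
  then have "upath E u (xs @ [v]) v"
    using upath_tree_path[OF assms(1), of u w] upath_prefix by metis
  then have "tree_path E u v = xs @ [v]"
    by (rule tree_path_eqI[OF assms(1)])
  then show ?thesis
    using path_edges_prefix_subset[of "xs @ [v]" ys] eq by simp
qed

lemma ancestor_ref_bus:
  assumes "tree (lines G)" "ancestor G m (ref_bus G)"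
  shows "m = ref_bus G"
proof -
  have "upath (lines G) (ref_bus G) [ref_bus G] (ref_bus G)"
    by (simp add: upath_def)
  then show ?thesis
    using assms tree_path_eqI unfolding ancestor_def by fastforce
qed

lemma path_matrix_nonneg: "0 \<le> path_matrix G $ e $ j"
  by (simp add: path_matrix_def)

lemma path_matrix_ancestor_mono:
  assumes "tree (lines G)" "ancestor G m n"
  shows "path_matrix G $ e $ m \<le> path_matrix G $ e $ n"
  using path_edges_tree_path_subset[of "lines G" m "ref_bus G" n] ancestor_ref_bus[of G m] assms
  by (auto simp: path_matrix_def ancestor_def)

text \<open>The impedance matrix is diagonal, so the double sum collapses to one over lines. The
  entry is thus linear in column \<open>j\<close> of the path matrix.\<close>

lemma voltage_sensitivity_entry:
  "(2 *\<^sub>R (transpose (path_matrix G) ** impedance_matrix G ** path_matrix G)) $ i $ j =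
     2 * (\<Sum>e\<in>UNIV. path_matrix G $ e $ i *
       (resistance G e + reactive_ratio G * reactance G e) * path_matrix G $ e $ j)"
  by (simp add: matrix_matrix_mult_def transpose_def impedance_matrix_def if_distrib cong: if_cong)

text \<open>The impedance has a known sign only on lines; on every other edge set the path matrix
  entry is zero.\<close>

lemma path_matrix_impedance_nonneg:
  assumes "radial_network G"
  shows "0 \<le> path_matrix G $ e $ i * (resistance G e + reactive_ratio G * reactance G e)"
  using assms by (auto simp: path_matrix_def radial_network_def)

lemma lindistflow_nonneg:
  assumes "radial_network G"
  shows "0 \<le> lindistflow G $ l $ j"
  unfolding lindistflow_def
  \<comment> \<open>Pushing the factor 2 into the components would keep
    \<open>voltage_sensitivity_entry\<close> from matching, hence the deleted simp rule.\<close>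
  by (auto simp: voltage_sensitivity_entry path_matrix_nonneg
      simp del: vector_scaleR_component split: sum.split
      intro!: sum_nonneg mult_nonneg_nonneg path_matrix_impedance_nonneg[OF assms])

lemma lindistflow_ancestor_mono:
  assumes "radial_network G" "ancestor G m n"
  shows "lindistflow G $ l $ m \<le> lindistflow G $ l $ n"
proof (cases "m = ref_bus G")
  case True
  then have "lindistflow G $ l $ m = 0"
    by (simp add: lindistflow_def)
  then show ?thesis
    using lindistflow_nonneg[OF assms(1)] by metis
next
  case False
  have tree: "tree (lines G)"
    using assms(1) by (simp add: radial_network_def)
  \<comment> \<open>The zero column of the reference bus could break monotonicity only at
    \<open>n\<close>, but that bus has no ancestor besides itself.\<close>
  then have "n \<noteq> ref_bus G"
    using False ancestor_ref_bus assms(2) by metis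
  with False show ?thesis
    unfolding lindistflow_def
    by (auto simp: voltage_sensitivity_entry simp del: vector_scaleR_component split: sum.split
        intro!: sum_mono mult_left_mono path_matrix_impedance_nonneg[OF assms(1)]
          path_matrix_ancestor_mono[OF tree assms(2)])
qed

lemma A_pos_eq: "radial_network (network R) \<Longrightarrow> A_pos R = lindistflow (network R)"
  by (simp add: A_pos_def mat_pos_def vec_eq_iff lindistflow_nonneg)

lemma A_neg_eq: "radial_network (network R) \<Longrightarrow> A_neg R = 0"
  using A_pos_eq[of R] by (simp add: A_neg_def A_pos_def mat_neg_def)

text \<open>Outside the cost the Lagrangian is affine in \<open>P_up\<close>, which enters the upper
  limits through \<open>A_pos\<close> and the lower ones through \<open>A_neg\<close>.\<close>

lemma lagrangian_shift_P_up:
  "lagrangian R Y (X\<lparr>P_up := P_up X + d\<rparr>) = lagrangian R Y X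
     + (cost R (P_up X + d, P_dn X) - cost R (P_up X, P_dn X))
     - lambda_up Y \<bullet> d + omega_up Y \<bullet> d
     + (\<Sum>l\<in>limit_rows (network R). mu_up Y $ l * (A_pos R *v d) $ l)
     + (\<Sum>l\<in>limit_rows (network R). mu_dn Y $ l * (A_neg R *v d) $ l)"
  by (simp add: lagrangian_def inner_right_distrib inner_diff_right
      matrix_vector_right_distrib algebra_simps sum.distrib sum_subtractf)

lemma lagrangian_shift_P_dn:
  "lagrangian R Y (X\<lparr>P_dn := P_dn X + d\<rparr>) = lagrangian R Y X
     + (cost R (P_up X, P_dn X + d) - cost R (P_up X, P_dn X))
     - lambda_dn Y \<bullet> d + omega_dn Y \<bullet> d
     + (\<Sum>l\<in>limit_rows (network R). mu_up Y $ l * (A_neg R *v d) $ l)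
     + (\<Sum>l\<in>limit_rows (network R). mu_dn Y $ l * (A_pos R *v d) $ l)"
  by (simp add: lagrangian_def inner_right_distrib inner_diff_right
      matrix_vector_right_distrib algebra_simps sum.distrib sum_subtractf)

lemma omega_up_eq_0:
  assumes "compl_slack R X Y" "\<And>i. P_up X $ i < Pmax_up R $ i"
  shows "omega_up Y = 0"
  using assms unfolding compl_slack_def vec_eq_iff
  by (metis diff_gt_0_iff_gt less_irrefl minus_diff_eq mult_eq_0_iff neg_equal_0_iff_equal
      vector_minus_component zero_index)

lemma omega_dn_eq_0:
  assumes "compl_slack R X Y" "\<And>i. P_dn X $ i < Pmax_dn R $ i"
  shows "omega_dn Y = 0"
  using assms unfolding compl_slack_def vec_eq_iff
  by (metis diff_gt_0_iff_gt less_irrefl minus_diff_eq mult_eq_0_iff neg_equal_0_iff_equal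
      vector_minus_component zero_index)

text \<open>The coordinates of the direction sum to zero, so a cost with the same coefficient at
  every bus does not change.\<close>

lemma sum_shift_axis_diff:
  fixes P :: "real ^ 'n::finite"
  shows "(\<Sum>i\<in>UNIV. c * (P + (axis m 1 - axis n 1)) $ i) = (\<Sum>i\<in>UNIV. c * P $ i)"
proof -
  have "(\<Sum>i\<in>UNIV. axis j (1::real) $ i) = 1" for j :: 'n
    by (simp add: axis_def)
  then show ?thesis
    by (simp add: sum.distrib sum_subtractf flip: sum_distrib_left)
qed

text \<open>Applied to the direction, the matrix gives column \<open>m\<close> minus column
  \<open>n\<close>.\<close>

lemma weighted_lindistflow_axis_diff_nonpos:
  fixes mu :: "real ^ ('n set + 'n::finite)"
  assumes "radial_network G" "ancestor G m n" "\<And>l. l \<in> L \<Longrightarrow> 0 \<le> mu $ l"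
  shows "(\<Sum>l\<in>L. mu $ l * (lindistflow G *v (axis m 1 - axis n 1)) $ l) \<le> 0"
  using lindistflow_ancestor_mono[OF assms(1,2)] assms(3)
  by (auto simp: matrix_vector_mult_diff_distrib matrix_vector_mul_component inner_axis
      intro!: sum_nonpos mult_nonneg_nonpos)

theorem proposition3:
  fixes R :: "('n::finite) access_problem"
    and X :: "'n primal_point" and Y :: "'n dual_point"
    and J_up J_dn :: real and m n :: 'n
  assumes "robust_access_problem R"
    and "primal_dual_optimal R X Y"
    and "\<And>P Q :: real ^ 'n. cost R (P, Q) = (\<Sum>i\<in>UNIV. J_up * P $ i) + (\<Sum>i\<in>UNIV. J_dn * Q $ i)"
    and "\<And>i. P_up X $ i < Pmax_up R $ i" and "\<And>i. P_dn X $ i < Pmax_dn R $ i"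
    and "ancestor (network R) m n"
  shows "lambda_up Y $ n \<ge> lambda_up Y $ m \<and> lambda_dn Y $ n \<ge> lambda_dn Y $ m"
proof -
  let ?d = "axis m 1 - axis n 1 :: real ^ 'n"
  have radial: "radial_network (network R)"
    using assms(1) by (simp add: robust_access_problem_def)
  have min: "lagrangian R Y X \<le> lagrangian R Y X'" for X'
    using assms(2) by (simp add: primal_dual_optimal_def)
  have slack: "compl_slack R X Y"
    using assms(2) by (simp add: primal_dual_optimal_def)
  have mu: "0 \<le> mu_up Y $ l" "0 \<le> mu_dn Y $ l" if "l \<in> limit_rows (network R)" for l
    using assms(2) that by (auto simp: primal_dual_optimal_def dual_nonneg_def)
  have cost: "cost R (P_up X + ?d, P_dn X) = cost R (P_up X, P_dn X)"
    "cost R (P_up X, P_dn X + ?d) = cost R (P_up X, P_dn X)"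
    unfolding assms(3) sum_shift_axis_diff by simp_all
  note nonpos = weighted_lindistflow_axis_diff_nonpos[OF radial assms(6), where L = "limit_rows (network R)"]
  \<comment> \<open>The shifted point violates the coupling of \<open>P_up\<close> with
    \<open>C_up\<close> unless \<open>m = n\<close>, but minimality of the Lagrangian ranges over
    all points, feasible or not.\<close>
  have "lambda_up Y \<bullet> ?d \<le> 0"
    using min[of "X\<lparr>P_up := P_up X + ?d\<rparr>"] nonpos[OF mu(1)]
    unfolding lagrangian_shift_P_up cost omega_up_eq_0[OF slack assms(4)]
      A_pos_eq[OF radial] A_neg_eq[OF radial] by simp
  moreover have "lambda_dn Y \<bullet> ?d \<le> 0"
    using min[of "X\<lparr>P_dn := P_dn X + ?d\<rparr>"] nonpos[OF mu(2)]
    unfolding lagrangian_shift_P_dn cost omega_dn_eq_0[OF slack assms(5)]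
      A_pos_eq[OF radial] A_neg_eq[OF radial] by simp
  ultimately show ?thesis
    by (simp add: inner_diff_right inner_axis)
qed

end
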